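(* For every positive integer $n>1$ there is a prime number $p$ with $5n<p<6n$. *)

theory Defs
  imports Complex_Main "HOL-Computational_Algebra.Primes"
begin

end

theory Submission
  imports Defs "HOL-Number_Theory.Prime_Powers" "HOL-Analysis.Harmonic_Numbers"
    "HOL-Library.Discrete_Functions"
begin

text \<open>
  Chebyshev's method. With \<open>T(n) = ln n!\<close>, the combination
  \<open>T(n) - T(n/2) - T(n/3) - T(n/5) + T(n/30)\<close> is \<open>A n + O(\<surd>n)\<close>, where
  \<open>A = ln 2/2 + ln 3/3 + ln 5/5 - ln 30/30\<close>, and it lies between
  \<open>\<psi>(n) - \<psi>(n/6) + \<psi>(n/7) - \<psi>(n/10)\<close> and \<open>\<psi>(n)\<close>. Dropping \<open>\<psi>(n/7) - \<psi>(n/10)\<close> yields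
  \<open>A n \<lesssim> \<psi>(n) \<lesssim> 6/5 A n\<close>, which just fails to give \<open>\<psi>(6n) > \<psi>(5n)\<close>; keeping that term improves
  \<open>6/5\<close> to \<open>1026/875\<close>, which suffices. As proper prime powers contribute only \<open>O(\<surd>n)\<close>, there is
  a prime between \<open>5n\<close> and \<open>6n\<close> for \<open>n \<ge> 300000\<close>. A chain of primes with successive ratios below
  \<open>6/5\<close> settles the smaller \<open>n\<close>.
\<close>

subsection \<open>Chebyshev bounds\<close>

definition chebyshev_psi :: "nat \<Rightarrow> real" where
  "chebyshev_psi n = (\<Sum>k=1..n. mangoldt k)"

text \<open>Passing from \<open>n\<close> to \<open>Suc n\<close> adds \<open>ln (Suc n)\<close>,
  the sum of \<open>mangoldt\<close> over its divisors, and \<open>n div d\<close> grows by one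
  exactly for those \<open>d\<close>. The free bound \<open>N\<close> puts all factorials over one
  range.\<close>

lemma ln_fact_eq_sum_mangoldt:
  assumes "n \<le> N"
  shows "ln (fact n) = (\<Sum>d=1..N. mangoldt d * real (n div d))"
  using assms
proof (induction n)
  case (Suc n)
  have "ln (fact (Suc n)) = ln (real (Suc n)) + ln (fact n)"
    by (simp add: ln_mult del: of_nat_Suc)
  also have "ln (real (Suc n)) = (\<Sum>d | d dvd Suc n. mangoldt d)"
    using mangoldt_sum[of "Suc n", where ?'a = real] by simp
  also have "\<dots> = (\<Sum>d=1..N. if d dvd Suc n then mangoldt d else 0)"
  proof (intro sum.mono_neutral_cong_left)
    show "{d. d dvd Suc n} \<subseteq> {1..N}"
    proof
      fix d assume "d \<in> {d. d dvd Suc n}"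
      then have d: "d dvd Suc n" by simp
      show "d \<in> {1..N}"
        using dvd_imp_le[OF d] dvd_pos_nat[OF _ d] Suc.prems by simp
    qed
  qed auto
  also have "ln (fact n) = (\<Sum>d=1..N. mangoldt d * real (n div d))"
    using Suc by simp
  finally show ?case
    by (simp only: sum.distrib[symmetric])
       (auto intro!: sum.cong simp: div_Suc dvd_eq_mod_eq_0 algebra_simps)
qed simp

text \<open>Puts all values of \<psi> on the range \<open>1..n\<close>, so that inequalities reduce
  to coefficients.\<close>

lemma chebyshev_psi_div:
  assumes "a > 0"
  shows "chebyshev_psi (n div a) = (\<Sum>d=1..n. mangoldt d * of_bool (a \<le> n div d))"
proof -
  have "d \<le> n div a \<longleftrightarrow> a \<le> n div d" if "d > 0" for d
    using that assms by (simp add: less_eq_div_iff_mult_less_eq mult.commute)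
  moreover have "n div a \<le> n" by simp
  ultimately show ?thesis
    unfolding chebyshev_psi_def
    by (intro sum.mono_neutral_cong_left) (auto simp: Suc_le_eq intro: le_trans)
qed

lemma chebyshev_psi_mono: "m \<le> n \<Longrightarrow> chebyshev_psi m \<le> chebyshev_psi n"
  unfolding chebyshev_psi_def by (intro sum_mono2) (auto simp: mangoldt_nonneg)

section \<open>Chebyshev's combination of logarithms of factorials\<close>

definition chebyshev_comb :: "nat \<Rightarrow> real" where
  "chebyshev_comb n = ln (fact n) - ln (fact (n div 2)) - ln (fact (n div 3))
     - ln (fact (n div 5)) + ln (fact (n div 30))"

text \<open>The function \<open>E\<close> is 30-periodic because \<open>1 - 1/2 - 1/3 - 1/5 + 1/30 = 0\<close>; this is
  Chebyshev's choice of coefficients.\<close>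

lemma chebyshev_coeff:
  defines "E \<equiv> \<lambda>m::nat. int m - int (m div 2) - int (m div 3) - int (m div 5) + int (m div 30)"
  shows "E m \<le> of_bool (1 \<le> m)"
    and "of_bool (1 \<le> m) - of_bool (6 \<le> m) + of_bool (7 \<le> m) - of_bool (10 \<le> m) \<le> E m"
proof -
  define q r where "q = m div 30" and "r = m mod 30"
  have m: "m = 30 * q + r" and "r < 30" by (auto simp: q_def r_def)
  have "E m = E r"
  proof -
    have "m div 2 = 15 * q + r div 2" "m div 3 = 10 * q + r div 3"
      "m div 5 = 6 * q + r div 5" "m div 30 = q + r div 30"
      unfolding m by presburger+
    then show ?thesis by (simp add: E_def m)
  qed
  moreover have "r \<in> {0, 1, 2, 3, 4, 5, 6, 7, 8, 9, 10, 11, 12, 13, 14, 15,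
      16, 17, 18, 19, 20, 21, 22, 23, 24, 25, 26, 27, 28, 29}"
    using \<open>r < 30\<close> by (simp add: numeral_eq_Suc less_Suc_eq)
  \<comment> \<open>Nonnegativity serves \<open>q > 0\<close>: there all four indicators are 1 and
    the claim is \<open>0 \<le> E m \<le> 1\<close>.\<close>
  then have "0 \<le> E r \<and> E r \<le> of_bool (1 \<le> r) \<and>
      of_bool (1 \<le> r) - of_bool (6 \<le> r) + of_bool (7 \<le> r) - of_bool (10 \<le> r) \<le> E r"
    unfolding E_def by (elim insertE emptyE; simp)
  ultimately have "E m \<le> of_bool (1 \<le> m) \<and>
      of_bool (1 \<le> m) - of_bool (6 \<le> m) + of_bool (7 \<le> m) - of_bool (10 \<le> m) \<le> E m"
    using m by (cases "q = 0") (auto simp: of_bool_def split: if_splits)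
  then show "E m \<le> of_bool (1 \<le> m)"
    and "of_bool (1 \<le> m) - of_bool (6 \<le> m) + of_bool (7 \<le> m) - of_bool (10 \<le> m) \<le> E m"
    by auto
qed

lemma chebyshev_comb_eq_sum:
  "chebyshev_comb n = (\<Sum>d=1..n. mangoldt d * of_int (int (n div d) - int (n div d div 2)
     - int (n div d div 3) - int (n div d div 5) + int (n div d div 30)))"
proof -
  have "ln (fact (n div a)) = (\<Sum>d=1..n. mangoldt d * real (n div d div a))" for a
    using ln_fact_eq_sum_mangoldt[of "n div a" n]
    by (simp add: div_mult2_eq[symmetric] mult.commute)
  then show ?thesis
    using ln_fact_eq_sum_mangoldt[of n n]
    by (simp add: chebyshev_comb_def sum_subtractf[symmetric] sum.distrib[symmetric] algebra_simps)
qed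

lemma chebyshev_comb_le_psi: "chebyshev_comb n \<le> chebyshev_psi n"
proof -
  have "chebyshev_psi n = (\<Sum>d=1..n. mangoldt d * of_int (of_bool (1 \<le> n div d)))"
    using chebyshev_psi_div[of 1 n] by simp
  then show ?thesis
    unfolding chebyshev_comb_eq_sum
    by (simp only:) (intro sum_mono mult_left_mono,
      simp_all only: of_int_le_iff chebyshev_coeff mangoldt_nonneg)
qed

lemma psi_le_chebyshev_comb:
  "chebyshev_psi n - chebyshev_psi (n div 6) + chebyshev_psi (n div 7) - chebyshev_psi (n div 10)
     \<le> chebyshev_comb n"
proof -
  have "chebyshev_psi n - chebyshev_psi (n div 6) + chebyshev_psi (n div 7) - chebyshev_psi (n div 10)
     = (\<Sum>d=1..n. mangoldt d * of_int (of_bool (1 \<le> n div d) - of_bool (6 \<le> n div d)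
         + of_bool (7 \<le> n div d) - of_bool (10 \<le> n div d)))"
    using chebyshev_psi_div[of 1 n]
    by (simp add: chebyshev_psi_div sum_subtractf sum.distrib distrib_left right_diff_distrib
        del: sum_mult_of_bool_eq)
  then show ?thesis
    unfolding chebyshev_comb_eq_sum
    by (simp only:) (intro sum_mono mult_left_mono,
      simp_all only: of_int_le_iff chebyshev_coeff mangoldt_nonneg)
qed

section \<open>Comparison of ln n! with the integral of ln from 1\<close>

definition ln_integral :: "real \<Rightarrow> real" where
  "ln_integral x = x * ln x - x + 1"

text \<open>The derivative of \<^const>\<open>ln_integral\<close> is \<^const>\<open>ln\<close>, so this is the tangent inequality at \<open>x\<close>.\<close>

lemma ln_integral_convex:
  assumes "x > 0" "y > 0"
  shows "(y - x) * ln x \<le> ln_integral y - ln_integral x"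
proof -
  have "y * (ln x - ln y) \<le> x - y"
    using ln_diff_le[of x y] assms by (simp add: field_simps)
  then show ?thesis by (simp add: ln_integral_def algebra_simps)
qed

text \<open>Tangents at \<open>n\<close> and \<open>Suc n\<close> give \<open>ln n \<le> ln_integral
  (Suc n) - ln_integral n \<le> ln (Suc n)\<close>; these are summed.\<close>

lemma ln_fact_bounds:
  assumes "n \<ge> 1"
  shows "ln_integral n \<le> ln (fact n)" "ln (fact n) \<le> ln_integral n + ln n"
proof -
  have "ln_integral n \<le> ln (fact n) \<and> ln (fact n) \<le> ln_integral n + ln n"
    using assms
  proof (induction n rule: nat_induct_at_least)
    case (Suc n)
    have "ln (fact (Suc n)) = ln (real (Suc n)) + ln (fact n)"
      by (simp add: ln_mult del: of_nat_Suc)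
    then show ?case
      using Suc ln_integral_convex[of n "Suc n"] ln_integral_convex[of "Suc n" n] by simp
  qed (simp add: ln_integral_def)
  then show "ln_integral n \<le> ln (fact n)" "ln (fact n) \<le> ln_integral n + ln n" by auto
qed

text \<open>For \<open>n \<ge> 1\<close>, \<open>ln_integral\<close> grows by at most
  \<open>ln x\<close> from \<open>n\<close> to \<open>x\<close>. The maxima cover
  \<open>n = 0\<close>, where \<open>ln x\<close> may be negative and \<open>ln_integral x\<close>
  lies between 0 and 1.\<close>

lemma ln_fact_floor_bounds:
  fixes x :: real
  assumes "x > 0" "real n \<le> x" "x \<le> real n + 1"
  shows "ln (fact n) \<le> ln_integral x + max 0 (ln x)"
    and "ln_integral x - max 1 (ln x) \<le> ln (fact n)"
proof -
  have "ln (fact n) \<le> ln_integral x + max 0 (ln x) \<and> ln_integral x - max 1 (ln x) \<le> ln (fact n)"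
  proof (cases "n = 0")
    case True
    have "x * ln x \<le> 0" using assms True by (simp add: mult_nonneg_nonpos)
    then show ?thesis
      using ln_integral_convex[of 1 x] assms True by (auto simp: ln_integral_def max_def)
  next
    case False
    then have n: "real n \<ge> 1" by simp
    have "0 \<le> (x - n) * ln n" using n assms by simp
    moreover have "(x - n) * ln x \<le> 1 * ln x" using n assms by (intro mult_right_mono) auto
    moreover have "(n - x) * ln x = - ((x - n) * ln x)" by (simp add: algebra_simps)
    moreover have "ln n \<le> ln x" using n assms by simp
    moreover have "n \<ge> 1" using n by simp
    note ln_fact_bounds[OF this]
    moreover have "(x - n) * ln n \<le> ln_integral x - ln_integral n"
      "(n - x) * ln x \<le> ln_integral n - ln_integral x"
      using n assms by (intro ln_integral_convex; simp)+
    ultimately have "ln (fact n) \<le> ln_integral x + ln x \<and> ln_integral x - ln x \<le> ln (fact n)"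
      by linarith
    then show ?thesis by linarith
  qed
  then show "ln (fact n) \<le> ln_integral x + max 0 (ln x)"
    and "ln_integral x - max 1 (ln x) \<le> ln (fact n)" by auto
qed

definition chebyshev_const :: real where
  "chebyshev_const = ln 2 / 2 + ln 3 / 3 + ln 5 / 5 - ln 30 / 30"

lemma chebyshev_const_bounds: "5/6 \<le> chebyshev_const" "chebyshev_const \<le> 4/3"
proof -
  have "ln (30::real) = ln (2 * 3 * 5)" by simp
  also have "\<dots> = ln 2 + ln 3 + ln 5" by (simp only: ln_mult_pos)
  finally have const: "30 * chebyshev_const = 14 * ln 2 + 9 * ln 3 + 5 * ln 5"
    by (simp add: chebyshev_const_def field_simps)
  \<comment> \<open>With e \<le> 3, the lower bound becomes the integer inequality 3^25 \<le> 2^14 *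
    3^9 * 5^5.\<close>
  have "exp 25 = exp (1::real) ^ 25" by (simp flip: exp_of_nat_mult)
  also have "\<dots> \<le> 3 ^ 25" by (intro power_mono exp_le) simp
  also have "\<dots> \<le> 2 ^ 14 * 3 ^ 9 * 5 ^ 5" by simp
  finally have "25 \<le> ln (2 ^ 14 * 3 ^ 9 * 5 ^ 5 :: real)" by (subst ln_ge_iff) simp_all
  also have "\<dots> = 14 * ln 2 + 9 * ln 3 + 5 * ln 5"
    by (simp only: ln_mult_pos ln_realpow zero_less_power zero_less_numeral mult_pos_pos of_nat_numeral)
  finally show "5/6 \<le> chebyshev_const" using const by simp
  have "ln (3::real) \<le> ln (2 ^ 2)" "ln (5::real) \<le> ln (2 ^ 3)" by simp_all
  then have "ln (3::real) \<le> 2 * ln 2" "ln (5::real) \<le> 3 * ln 2"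
    by (simp_all only: ln_realpow zero_less_numeral of_nat_numeral)
  then show "chebyshev_const \<le> 4/3" using const ln2_le_25_over_36 by simp
qed

text \<open>This is \<open>ln y \<le> y - 1\<close> at \<open>y = sqrt x / 2\<close>. The left side
  is the worst total error in \<open>chebyshev_comb_approx\<close>: one \<open>ln\<close> per
  factorial, plus constants.\<close>

lemma ln_le_sqrt:
  assumes "x > 0"
  shows "5 * ln x + 3 \<le> 5 * sqrt x"
proof -
  have "ln (sqrt x / 2) \<le> sqrt x / 2 - 1" using assms by (intro ln_le_minus_one) simp
  then have "ln x / 2 - ln 2 \<le> sqrt x / 2 - 1" using assms by (simp add: ln_div ln_sqrt)
  then show ?thesis using ln2_le_25_over_36 by simp
qed

lemma chebyshev_comb_approx:
  shows "chebyshev_comb n \<le> chebyshev_const * n + 5 * sqrt n"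
    and "chebyshev_const * n - 5 * sqrt n \<le> chebyshev_comb n"
proof -
  have "chebyshev_comb n \<le> chebyshev_const * n + 5 * sqrt n \<and>
    chebyshev_const * n - 5 * sqrt n \<le> chebyshev_comb n"
  proof (cases "n = 0")
    case False
    then have n: "real n \<ge> 1" by simp
    have bounds: "ln (fact (n div d)) \<le> ln_integral (n / d) + ln n"
      "ln_integral (n / d) - (1 + ln n) \<le> ln (fact (n div d))" if "d > 0" for d
    proof -
      have "real (n div d) \<le> n / d" "n / d \<le> real (n div d) + 1"
        using of_nat_div_le_of_nat[of n d, where ?'a = real] that
          floor_divide_of_nat_eq[of n d, where ?'a = real] by linarith+
      moreover have "ln (n / d) \<le> ln n" using n that by (simp add: divide_le_eq)
      moreover have "ln n \<ge> 0" using n by simp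
      moreover have "0 < real n / d" using n that by simp
      ultimately show "ln (fact (n div d)) \<le> ln_integral (n / d) + ln n"
        "ln_integral (n / d) - (1 + ln n) \<le> ln (fact (n div d))"
        using ln_fact_floor_bounds[of "n / d" "n div d"] by linarith+
    qed
    \<comment> \<open>As 1 - 1/2 - 1/3 - 1/5 + 1/30 = 0, the terms in \<open>n * ln n\<close> and
      the plain terms in \<open>n\<close> cancel; the five constants 1 add up to -1 with their
      signs.\<close>
    have "ln_integral n - ln_integral (n / 2) - ln_integral (n / 3) - ln_integral (n / 5)
        + ln_integral (n / 30) = chebyshev_const * n - 1"
      using n by (simp add: ln_integral_def chebyshev_const_def ln_div field_simps)
    moreover have "5 * ln n + 3 \<le> 5 * sqrt n" using n by (intro ln_le_sqrt) simp
    ultimately show ?thesis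
      using bounds[of 1] bounds[of 2] bounds[of 3] bounds[of 5] bounds[of 30]
      unfolding chebyshev_comb_def by simp
  qed (simp add: chebyshev_comb_def)
  then show "chebyshev_comb n \<le> chebyshev_const * n + 5 * sqrt n"
    and "chebyshev_const * n - 5 * sqrt n \<le> chebyshev_comb n" by auto
qed

section \<open>Lower and upper bounds for \<psi>\<close>

lemma psi_ge: "chebyshev_const * n - 5 * sqrt n \<le> chebyshev_psi n"
  using chebyshev_comb_approx(2)[of n] chebyshev_comb_le_psi[of n] by linarith

text \<open>Here \<open>c\<close> is a rational upper bound for \<open>1 / sqrt d\<close>, which
  keeps later error terms linear in \<open>sqrt n\<close>.\<close>

lemma sqrt_div_le:
  assumes "0 \<le> c" "1 \<le> c\<^sup>2 * real d"
  shows "sqrt (n div d) \<le> c * sqrt n"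
proof -
  have "real (n div d) \<le> (c\<^sup>2 * real d) * real (n div d)"
    using mult_right_mono[OF assms(2), of "real (n div d)"] by simp
  also have "\<dots> = c\<^sup>2 * real (d * (n div d))" by simp
  also have "\<dots> \<le> c\<^sup>2 * n" by (intro mult_left_mono of_nat_mono times_div_less_eq_dividend) simp
  finally have "sqrt (n div d) \<le> sqrt (c\<^sup>2 * n)" by (rule real_sqrt_le_mono)
  then show ?thesis using assms(1) by (simp add: real_sqrt_mult)
qed

lemma chebyshev_const_mult_div_le: "chebyshev_const * real (n div d) \<le> chebyshev_const * n / d"
  using mult_left_mono[OF of_nat_div_le_of_nat[of n d], of chebyshev_const] chebyshev_const_bounds
  by simp

text \<open>Iterating \<psi>(n) \<le> \<psi>(n/6) + A n + 5 \<surd>n produces 1 + 1/6 + 1/36 + ... =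
  6/5; the induction closes because 5 + 9 * 5/12 \<le> 9.\<close>

lemma psi_le_weak: "chebyshev_psi n \<le> 6/5 * (chebyshev_const * n) + 9 * sqrt n"
proof (induction n rule: less_induct)
  case (less n)
  show ?case
  proof (cases "n = 0")
    case False
    define k where "k = n div 6"
    have "chebyshev_psi k \<le> 6/5 * (chebyshev_const * k) + 9 * sqrt k"
      using False by (intro less) (simp add: k_def)
    moreover have "chebyshev_const * k \<le> chebyshev_const * n / 6"
      using chebyshev_const_mult_div_le[of n 6] by (simp add: k_def)
    moreover have "sqrt k \<le> 5/12 * sqrt n"
      unfolding k_def by (rule sqrt_div_le) (simp_all add: power2_eq_square)
    moreover have "chebyshev_psi (n div 10) \<le> chebyshev_psi (n div 7)"
      by (intro chebyshev_psi_mono div_le_mono2) auto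
    then have "chebyshev_psi n \<le> chebyshev_psi k + chebyshev_comb n"
      using psi_le_chebyshev_comb[of n] unfolding k_def by simp
    moreover have "0 \<le> sqrt n" by simp
    ultimately show ?thesis
      using chebyshev_comb_approx(1)[of n] by linarith
  qed (simp add: chebyshev_psi_def)
qed

text \<open>Instead of discarding \<open>\<psi>(n/7) - \<psi>(n/10)\<close> as in the previous bound, feed both bounds obtained so far
  into it: \<open>1026/875 = 6/5 * (1 - 1/7 + 3/25)\<close> is below \<open>6/5\<close>, which is what the theorem needs.\<close>

lemma psi_le: "chebyshev_psi n \<le> 1026/875 * (chebyshev_const * n) + 20 * sqrt n"
proof (induction n rule: less_induct)
  case (less n)
  show ?case
  proof (cases "n = 0")
    case False
    then have n: "sqrt n \<ge> 1" by simp
    define k6 k7 k10 where "k6 = n div 6" and "k7 = n div 7" and "k10 = n div 10"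
    have "chebyshev_psi k6 \<le> 1026/875 * (chebyshev_const * k6) + 20 * sqrt k6"
      using False by (intro less) (simp add: k6_def)
    moreover have "chebyshev_const * k6 \<le> chebyshev_const * n / 6"
      "chebyshev_const * k10 \<le> chebyshev_const * n / 10"
      using chebyshev_const_mult_div_le[of n 6] chebyshev_const_mult_div_le[of n 10]
      by (simp_all add: k6_def k10_def)
    moreover have "sqrt k6 \<le> 5/12 * sqrt n" "sqrt k7 \<le> 5/13 * sqrt n" "sqrt k10 \<le> 1/3 * sqrt n"
      unfolding k6_def k7_def k10_def by (rule sqrt_div_le; simp add: power2_eq_square)+
    \<comment> \<open>A lower bound is needed at \<open>k7\<close>, so rounding costs up to
      \<open>chebyshev_const\<close>, absorbed by \<open>sqrt n \<ge> 1\<close>.\<close>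
    moreover have "chebyshev_const * (n / 7 - 1) \<le> chebyshev_const * k7"
    proof (rule mult_left_mono)
      have "n \<le> 7 * k7 + 7" unfolding k7_def by presburger
      then show "n / 7 - 1 \<le> real k7" by linarith
    qed (use chebyshev_const_bounds in simp)
    then have "chebyshev_const * n / 7 - chebyshev_const \<le> chebyshev_const * k7"
      by (simp add: right_diff_distrib)
    moreover have "chebyshev_psi n - chebyshev_psi k6 + chebyshev_psi k7 - chebyshev_psi k10
        \<le> chebyshev_comb n"
      unfolding k6_def k7_def k10_def by (rule psi_le_chebyshev_comb)
    \<comment> \<open>The coefficients of \<open>sqrt n\<close> add up to 20 * 5/12 + 5 + 5 * 5/13 +
      9/3 + 4/3 < 20.\<close>
    ultimately show ?thesis
      using chebyshev_comb_approx(1)[of n] psi_ge[of k7] psi_le_weak[of k10]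
        chebyshev_const_bounds n by linarith
  qed (simp add: chebyshev_psi_def)
qed

text \<open>Since \<open>b < 2 * a\<close>, the interval contains at most one power of each prime.\<close>

lemma sum_mangoldt_proper_powers_le:
  assumes "b < 2 * a" and "\<And>p. prime p \<Longrightarrow> a < p \<Longrightarrow> p \<le> b \<Longrightarrow> False"
  shows "(\<Sum>k\<in>{a<..b}. mangoldt k) \<le> chebyshev_psi (floor_sqrt b)"
proof -
  define K where "K = {k\<in>{a<..b}. primepow k}"
  \<comment> \<open>Exponent 1 is excluded as the interval has no prime; an exponent of at least 2
    later bounds the base prime by the root of \<open>b\<close>.\<close>
  have decomp: "\<exists>j\<ge>2. k = aprimedivisor k ^ j \<and> prime (aprimedivisor k)" if "k \<in> K" for k
  proof -
    from that obtain p j where pj: "prime p" "j > 0" "k = p ^ j" by (auto simp: K_def primepow_def)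
    then have "j \<noteq> 1" using that assms(2)[of p] by (auto simp: K_def)
    then show ?thesis using pj by (intro exI[of _ j]) (simp add: aprimedivisor_prime_power)
  qed
  have le: "x \<le> y" if xy: "x \<in> K" "y \<in> K" "aprimedivisor x = aprimedivisor y" for x y
  proof -
    define p where "p = aprimedivisor x"
    obtain i j where p: "prime p" "x = p ^ i" "y = p ^ j"
      using decomp[OF xy(1)] decomp[OF xy(2)] unfolding p_def xy(3) by blast
    then have "2 \<le> p" by (simp add: prime_ge_2_nat)
    show ?thesis
    proof (rule ccontr)
      assume "\<not> x \<le> y"
      moreover have "x \<le> y" if "i \<le> j"
        using that \<open>2 \<le> p\<close> by (simp add: p power_increasing)
      ultimately have "Suc j \<le> i" by linarith
      then have "p ^ Suc j \<le> x" using \<open>2 \<le> p\<close> unfolding p(2) by (intro power_increasing) auto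
      moreover have "2 * y \<le> p ^ Suc j" using \<open>2 \<le> p\<close> by (simp add: p)
      ultimately show False using xy assms(1) by (auto simp: K_def)
    qed
  qed
  have inj: "inj_on aprimedivisor K" by (rule inj_onI, rule antisym; rule le; simp)
  have "(\<Sum>k\<in>{a<..b}. mangoldt k) = (\<Sum>k\<in>K. ln (real (aprimedivisor k)))"
    by (rule sum.mono_neutral_cong_right) (auto simp: K_def mangoldt_def)
  also have "\<dots> = (\<Sum>k\<in>K. mangoldt (aprimedivisor k))"
  proof (intro sum.cong refl)
    fix k assume "k \<in> K"
    then have "prime (aprimedivisor k)" using decomp by blast
    then show "ln (real (aprimedivisor k)) = mangoldt (aprimedivisor k)" by simp
  qed
  also have "\<dots> = (\<Sum>p\<in>aprimedivisor ` K. mangoldt p)"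
    by (simp add: sum.reindex[OF inj])
  also have "\<dots> \<le> chebyshev_psi (floor_sqrt b)"
    unfolding chebyshev_psi_def
  proof (rule sum_mono2)
    show "aprimedivisor ` K \<subseteq> {1..floor_sqrt b}"
    proof
      fix p assume "p \<in> aprimedivisor ` K"
      then obtain k j where k: "k \<in> K" "j \<ge> 2" "k = p ^ j" "prime p" using decomp by blast
      then have "p ^ 2 \<le> b"
        using power_increasing[of 2 j p] prime_ge_1_nat[of p] by (auto simp: K_def)
      then show "p \<in> {1..floor_sqrt b}" using k prime_ge_1_nat[of p] by (simp add: le_floor_sqrt_iff)
    qed
  qed (auto simp: mangoldt_nonneg)
  finally show ?thesis .
qed

text \<open>Without a prime, \<psi>(6n) - \<psi>(5n) is at most \<psi>(r) = O(\<surd>n), whereas the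
  bounds on \<psi> give at least (6 - 5 * 1026/875) A n = 24/175 A n up to O(\<surd>n).\<close>

lemma prime_between_large:
  assumes "n \<ge> 300000"
  shows "\<exists>p::nat. prime p \<and> 5 * n < p \<and> p < 6 * n"
proof (rule ccontr)
  assume "\<not> ?thesis"
  moreover have "\<not> prime (6 * n)"
    using assms by (auto dest: prime_product)
  ultimately have no: "\<And>p. prime p \<Longrightarrow> 5 * n < p \<Longrightarrow> p \<le> 6 * n \<Longrightarrow> False"
    by (metis le_neq_implies_less)
  define s where "s = sqrt n"
  define r where "r = floor_sqrt (6 * n)"
  note A = chebyshev_const_bounds
  \<comment> \<open>547 is the integer part of the root of 300000.\<close>
  have "sqrt (547\<^sup>2) \<le> s" unfolding s_def using assms by (intro real_sqrt_le_mono) simp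
  then have s: "547 \<le> s" by simp
  have sq: "s * s = n" by (simp add: s_def)
  have "sqrt 5 \<le> 2237/1000" "sqrt 6 \<le> 245/100"
    by (rule real_le_lsqrt; simp add: power2_eq_square)+
  then have roots: "sqrt (real (5 * n)) \<le> 2237/1000 * s" "sqrt (real (6 * n)) \<le> 245/100 * s"
    using s mult_right_mono[of "sqrt 5" "2237/1000" s] mult_right_mono[of "sqrt 6" "245/100" s]
    by (simp_all add: real_sqrt_mult flip: s_def)
  have "real r \<le> sqrt (real (6 * n))"
  proof (rule real_le_rsqrt)
    have "r\<^sup>2 \<le> 6 * n" by (simp add: r_def)
    then show "(real r)\<^sup>2 \<le> real (6 * n)" by (metis of_nat_le_iff of_nat_power)
  qed
  \<comment> \<open>Completing the square trades \<open>sqrt r\<close> for \<open>r\<close>, which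
    is at most 2.45 * s.\<close>
  moreover have "9 * sqrt r \<le> r / 5 + 102"
    using zero_le_power2[of "sqrt r - 45/2"] by (simp add: power2_eq_square algebra_simps)
  moreover have "chebyshev_const * r \<le> 4/3 * r" using A by (intro mult_right_mono) auto
  moreover have "{1..6 * n} = {1..5 * n} \<union> {5 * n<..6 * n}" by auto
  then have "chebyshev_psi (6 * n) = chebyshev_psi (5 * n) + (\<Sum>k\<in>{5 * n<..6 * n}. mangoldt k)"
    unfolding chebyshev_psi_def by (simp only:) (subst sum.union_disjoint, auto)
  moreover have "(\<Sum>k\<in>{5 * n<..6 * n}. mangoldt k) \<le> chebyshev_psi r"
    unfolding r_def using assms by (intro sum_mangoldt_proper_powers_le no) auto
  moreover have "5/6 * n \<le> chebyshev_const * n" using A by (intro mult_right_mono) auto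
  moreover have "547 * s \<le> n" using s unfolding sq[symmetric] by (intro mult_right_mono) auto
  moreover have "chebyshev_const * real (5 * n) = 5 * (chebyshev_const * n)"
    "chebyshev_const * real (6 * n) = 6 * (chebyshev_const * n)" by simp_all
  \<comment> \<open>The main term is at least 24/175 * 5/6 * n \<ge> 62.5 * s, the errors at most
    61.4 * s + 102.\<close>
  ultimately show False
    using psi_le_weak[of r] psi_le[of "5 * n"] psi_ge[of "6 * n"] roots s by linarith
qed

subsection \<open>Small cases\<close>

text \<open>State of a trial division whose odd candidates below \<open>d\<close> are done; the next
  two lemmas let the simplifier run it.\<close>

definition no_odd_divisor_from :: "nat \<Rightarrow> nat \<Rightarrow> bool" where
  "no_odd_divisor_from d p \<longleftrightarrow> (\<forall>e\<ge>d. odd e \<longrightarrow> e * e \<le> p \<longrightarrow> \<not> e dvd p)"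

lemma no_odd_divisor_from_stop: "p < d * d \<Longrightarrow> no_odd_divisor_from d p"
  unfolding no_odd_divisor_from_def by (meson le_trans mult_le_mono not_le)

lemma no_odd_divisor_from_step:
  assumes "odd d" "\<not> d dvd p"
  shows "no_odd_divisor_from d p \<longleftrightarrow> no_odd_divisor_from (d + 2) p"
proof -
  have "e = d \<or> d + 2 \<le> e" if "d \<le> e" "odd e" for e
    using that \<open>odd d\<close> by (metis Suc_leI add_2_eq_Suc' even_Suc le_neq_implies_less)
  then show ?thesis
    using assms unfolding no_odd_divisor_from_def by auto
qed

text \<open>In a proper factorization of an odd \<open>p\<close> the smaller factor is odd, at least
  3, and has square at most \<open>p\<close>.\<close>

lemma prime_if_no_odd_divisor:
  assumes "1 < p" "odd p" "no_odd_divisor_from 3 p"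
  shows "prime p"
proof (rule ccontr)
  assume "\<not> prime p"
  then obtain a b where ab: "p = a * b" "1 < a" "1 < b"
    using assms(1) by (metis One_nat_def Suc_lessI dvd_def mult_0 mult_0_right mult_1_right
      nat_neq_iff not_less0 prime_nat_iff less_one)
  have *: False if "p = a * b" "1 < a" "a \<le> b" for a b
  proof -
    have "odd a" using that \<open>odd p\<close> by simp
    moreover have "a \<noteq> 2" using \<open>odd a\<close> by auto
    ultimately show False
      using assms(3) that mult_le_mono2[of a b a]
      by (auto simp: no_odd_divisor_from_def dest!: spec[of _ a])
  qed
  show False
    using *[of a b] *[of b a] ab by (simp add: mult.commute) (meson nle_le)
qed

text \<open>A prime \<open>p\<close> serves every \<open>n\<close> with \<open>p/6 < n < p/5\<close>, that is, up to \<open>(p - 1) div 5\<close>.\<close>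

fun covers :: "nat \<Rightarrow> nat list \<Rightarrow> nat \<Rightarrow> bool" where
  "covers a [] b \<longleftrightarrow> b \<le> a"
| "covers a (p # ps) b \<longleftrightarrow> p < 6 * a \<and> covers ((p - 1) div 5 + 1) ps b"

text \<open>If \<open>5 * n < p\<close>, the first prime works because
  \<open>p < 6 * a \<le> 6 * n\<close>; otherwise \<open>n\<close> is past the range of
  \<open>p\<close> and the tail takes over.\<close>

lemma prime_between_if_covers:
  assumes "covers a ps b" "list_all prime ps" "a \<le> n" "n < b"
  shows "\<exists>p::nat. prime p \<and> 5 * n < p \<and> p < 6 * n"
  using assms
proof (induction ps arbitrary: a)
  case (Cons p ps)
  show ?case
  proof (cases "5 * n < p")
    case True
    then show ?thesis using Cons.prems by (intro exI[of _ p]) auto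
  next
    case False
    then have "(p - 1) div 5 + 1 \<le> n"
      using Cons.prems(2) prime_gt_0_nat[of p] by auto
    then show ?thesis using Cons.IH[of "(p - 1) div 5 + 1"] Cons.prems by simp
  qed
qed simp

text \<open>The first prime serves n = 2; the last one serves n up to 337108, past 300000.\<close>

definition prime_chain :: "nat list" where
  "prime_chain = [
    11, 17, 23, 29, 31, 41, 53, 61, 73, 89, 107, 131, 157, 191, 233, 281, 337, 401, 479,
    571, 683, 821, 983, 1181, 1409, 1669, 2003, 2399, 2879, 3449, 4139, 4967, 5953,
    7129, 8543, 10253, 12301, 14759, 17707, 21247, 25471, 30559, 36671, 43997, 52783,
    63337, 76003, 91199, 109433, 131321, 157579, 189067, 226871, 272249, 326693, 392033,
    470429, 564497, 677387, 812857, 975427, 1170511, 1404617, 1685543]"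

lemma list_all_prime_prime_chain: "list_all prime prime_chain"
  unfolding prime_chain_def
  by (simp add: prime_if_no_odd_divisor no_odd_divisor_from_stop no_odd_divisor_from_step
      del: prime_nat_numeral_eq)

lemma covers_prime_chain: "covers 2 prime_chain 300000"
  by (simp add: prime_chain_def)

theorem corollary2p2p12:
  fixes n :: nat
  assumes "n > 1"
  shows "\<exists>p::nat. prime p \<and> 5 * n < p \<and> p < 6 * n"
proof (cases "n < 300000")
  case True
  then show ?thesis
    using prime_between_if_covers[OF covers_prime_chain list_all_prime_prime_chain] assms by simp
next
  case False
  then show ?thesis using prime_between_large by simp
qed

end
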